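(* Let $d\ge 0$ be an integer and let $\lambda_0,\dots,\lambda_d$ be integers with $\sum_{i=0}^{d}|\lambda_i|>0$ and $\sum_{i=0}^{d}\lambda_i=0$; write $\underline{\lambda}=(\lambda_0,\dots,\lambda_d)$. Then for every positive integer $N$ there exists a set $A\subset\mathbb{N}$ such that \[ N \le \limsup_{n \to \infty}\frac{B(A, \underline{\lambda}, n)}{\sqrt{n}} < \infty \] and \[ \limsup_{n \to \infty}\left|\sum_{i=0}^{d}\lambda_{i}R_{A}(n - i)\right| \le \limsup_{n \to \infty}48(d+1)^4 2^{3d+7.5}\sum_{i=0}^d|\lambda _i|\left(\frac{B(A, \underline{\lambda}, n)}{\sqrt{n}}\right)^{3/2}\left(\log \frac{B(A, \underline{\lambda}, n)}{\sqrt{n}}\right)^{1/2}. \]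
   Context: $\mathbb{N}$ denotes the set of nonnegative integers; $\log$ is the natural logarithm. For a set $A$ of nonnegative integers and an integer $n$, $R_A(n)$ denotes the number of ordered pairs $(a,a')\in A\times A$ with $a+a'=n$ (so $R_A(n)=0$ for $n<0$). $\chi_A$ is the characteristic function of $A$ on the integers ($\chi_A(m)=0$ for $m<0$). For $\underline{\lambda}=(\lambda_0,\dots,\lambda_d)$ define $B(A,\underline{\lambda},n)=\#\{m\in\mathbb{Z}_{\ge 0}: m\le n,\ \sum_{i=0}^{d}\lambda_i\chi_A(m-i)\neq 0\}$. *)

theory Defs
  imports Complex_Main "HOL-Library.Extended_Real" "HOL-Library.Indicator_Function"
begin

definition R :: "nat set \<Rightarrow> int \<Rightarrow> nat" where
  "R A n = card {(a, a'). a \<in> A \<and> a' \<in> A \<and> int a + int a' = n}"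

text \<open>The arguments of \<open>R\<close> and of the characteristic function are integers, so that
  \<open>n - i\<close> and \<open>m - i\<close> are genuine (untruncated) differences.\<close>

definition chi :: "nat set \<Rightarrow> int \<Rightarrow> int" where
  "chi A = indicator (int ` A)"

text \<open>The tuple of coefficients is a function on \<open>nat\<close> of which only the values at
  \<open>0, ..., d\<close> are used.\<close>

definition B :: "nat set \<Rightarrow> nat \<Rightarrow> (nat \<Rightarrow> int) \<Rightarrow> nat \<Rightarrow> nat" where
  "B A d l n = card {m::nat. m \<le> n \<and> (\<Sum>i=0..d. l i * chi A (int m - int i)) \<noteq> 0}"

text \<open>Convention for half powers of logarithms: \<open>(log x)^(1/2)\<close> is written \<open>sqrt (ln x)\<close>. For
  \<open>0 < x < 1\<close>, where the real expression is undefined, the odd extension of \<open>sqrt\<close> gives a negative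
  value, so these terms cannot enlarge a limit superior whose relevant \<open>x\<close> have limit superior at
  least 1. By contrast, \<open>ln x powr (1/2)\<close> need not have this property, since \<open>powr\<close> with a
  negative base is only a totalised value.\<close>

end

theory Submission
  imports Defs "HOL-Computational_Algebra.Formal_Power_Series" "HOL-Computational_Algebra.Primes"
    "HOL-Real_Asymp.Real_Asymp"
begin

text \<open>Since the coefficients add up to \<open>0\<close>, it is enough to bound \<open>R\<^sub>A(n) - R\<^sub>A(n - 1)\<close>, the coefficients
  of \<open>(1 - X) A(X)\<^sup>2\<close>. Choose signs \<open>h\<^sub>0, ..., h\<^sub>M\<^sub>-\<^sub>1\<close> whose self-convolution is \<open>O(sqrt M log M)\<close>, and
  let \<open>T\<close> be the set of length \<open>P = 2 (d + 1) M\<close> in which each sign decides the order of a full and an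
  empty run of length \<open>d + 1\<close>. Up to bounded terms coming from the mean \<open>1/2\<close>, the coefficients of
  \<open>(1 - X) T(X)\<^sup>2\<close> are those of the self-convolution. Let \<open>S\<close> be an infinite set with bounded \<open>R\<^sub>S\<close> and
  limsup \<open>S(n) / sqrt n\<close> positive, and put \<open>A(X) = T(X) S(X\<^sup>2\<^sup>P)\<close>. No carries occur in \<open>A + A\<close>, so the
  differences of \<open>R\<^sub>A\<close> are still \<open>O(sqrt M log M)\<close>. On the other hand each of the \<open>M\<close> blocks of each
  copy of \<open>T\<close> contributes to \<open>B\<close>, whence the limsup \<open>c\<close> of \<open>B / sqrt n\<close> is at least a constant times
  \<open>sqrt M\<close>. As \<open>M\<close> grows, \<open>sqrt M log M\<close> is eventually smaller than \<open>c\<^sup>3\<^sup>/\<^sup>2\<close>.\<close>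

unbundle fps_syntax

subsection \<open>Signs with small self-convolution\<close>

text \<open>Each pair of distinct indices with sum \<open>n\<close> is counted once, at its larger
  member \<open>j\<close>, so raising \<open>M\<close> by one adds at most one term. The diagonal is
  treated separately.\<close>

definition pair_sum :: "nat \<Rightarrow> (nat \<Rightarrow> int) \<Rightarrow> nat \<Rightarrow> int" where
  "pair_sum M e n = (\<Sum>j<M. if j \<le> n \<and> n - j < j then e j * e (n - j) else 0)"

lemma pair_sum_cong: "(\<And>i. i < M \<Longrightarrow> e i = e' i) \<Longrightarrow> pair_sum M e n = pair_sum M e' n"
  unfolding pair_sum_def by (intro sum.cong) auto

lemma pair_sum_Suc:
  "pair_sum (Suc M) e n = pair_sum M e n + (if M \<le> n \<and> n - M < M then e M * e (n - M) else 0)"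
  by (simp add: pair_sum_def)

text \<open>The signs are chosen one after the other. Each new sign enters every pair sum in at most one
  pair, so averaging \<open>cosh\<close> over its two values costs a factor of at most \<open>cosh s\<close>; one of the two
  values is at least as good as the average.\<close>

lemma signs_cosh_potential:
  fixes s :: real
  shows "\<exists>e::nat \<Rightarrow> int. (\<forall>i. e i = 1 \<or> e i = -1) \<and>
    (\<Sum>n<K. cosh (s * pair_sum M e n)) \<le> K * cosh s ^ M"
proof (induction M)
  case 0
  show ?case by (intro exI[of _ "\<lambda>_. 1"]) (simp add: pair_sum_def)
next
  case (Suc M)
  then obtain e :: "nat \<Rightarrow> int" where e: "\<And>i. e i = 1 \<or> e i = -1"
    and pot: "(\<Sum>n<K. cosh (s * pair_sum M e n)) \<le> K * cosh s ^ M" by blast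
  define F where "F c = (\<Sum>n<K. cosh (s * pair_sum (Suc M) (e(M := c)) n))" for c
  \<comment> \<open>\<open>a n\<close> is the partner of the new sign in the \<open>n\<close>-th
    sum, or 0 if that sum does not contain the new sign.\<close>
  define a where "a n = (if M \<le> n \<and> n - M < M then e (n - M) else 0)" for n
  have a: "a n = 0 \<or> a n = 1 \<or> a n = -1" for n
    using e[of "n - M"] by (auto simp: a_def)
  have step: "pair_sum (Suc M) (e(M := c)) n = pair_sum M e n + c * a n" for c n
    unfolding pair_sum_Suc a_def using pair_sum_cong[of M "e(M := c)" e n] by auto
  have "F 1 + F (-1) \<le> (\<Sum>n<K. 2 * cosh s * cosh (s * pair_sum M e n))"
    unfolding F_def step sum.distrib[symmetric]
  proof (rule sum_mono)
    fix n
    let ?X = "s * pair_sum M e n"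
    have "cosh (s * a n) \<le> cosh s"
      using a[of n] cosh_real_ge_1[of s] by auto
    moreover have "cosh (?X + s * a n) + cosh (?X - s * a n) = 2 * cosh (s * a n) * cosh ?X"
      by (simp add: cosh_add cosh_diff)
    ultimately show "cosh (s * real_of_int (pair_sum M e n + 1 * a n))
        + cosh (s * real_of_int (pair_sum M e n + - 1 * a n)) \<le> 2 * cosh s * cosh ?X"
      by (simp add: algebra_simps)
  qed
  also have "\<dots> = 2 * (cosh s * (\<Sum>n<K. cosh (s * pair_sum M e n)))"
    by (simp add: sum_distrib_left mult_ac)
  also have "\<dots> \<le> 2 * (K * cosh s ^ Suc M)"
    using mult_left_mono[OF pot, of "cosh s"] by (simp add: mult_ac)
  finally have "F 1 \<le> K * cosh s ^ Suc M \<or> F (-1) \<le> K * cosh s ^ Suc M" by linarith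
  then obtain c where c: "c = 1 \<or> c = -1" "F c \<le> K * cosh s ^ Suc M" by blast
  show ?case
  proof (intro exI conjI allI)
    show "(e(M := c)) i = 1 \<or> (e(M := c)) i = -1" for i using c(1) e[of i] by simp
  qed (use c(2) in \<open>simp only: F_def\<close>)
qed

lemma cosh_le_exp_square:
  fixes s :: real
  assumes "0 \<le> s" "s \<le> 1"
  shows "cosh s \<le> exp (s\<^sup>2)"
proof -
  have "exp s \<le> 1 + s + s\<^sup>2" using exp_bound assms by blast
  moreover have "exp (-s) \<le> 1 - s + s\<^sup>2"
  proof -
    \<comment> \<open>The product equals \<open>1 + s ^ 3\<close>; this bounds
      \<open>1 - s + s\<^sup>2\<close> below by the reciprocal of \<open>exp s\<close>.\<close>
    have "1 \<le> (1 + s) * (1 - s + s\<^sup>2)" using assms by (simp add: algebra_simps power2_eq_square)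
    also have "\<dots> \<le> exp s * (1 - s + s\<^sup>2)"
      using assms by (intro mult_right_mono) (auto simp: exp_ge_add_one_self)
    finally show ?thesis by (simp add: exp_minus field_simps)
  qed
  ultimately have "cosh s \<le> 1 + s\<^sup>2" by (simp add: cosh_field_def)
  then show ?thesis using exp_ge_add_one_self[of "s\<^sup>2"] by linarith
qed

text \<open>With \<open>s = 1 / sqrt M\<close> the factor \<open>cosh s ^ M\<close> stays below
  \<open>exp 1\<close>. Each single \<open>cosh\<close> is at most the whole potential, here at most
  \<open>2 * M * exp 1\<close>, and taking logarithms bounds the pair sum.\<close>

lemma signs_small_pair_sums:
  fixes M :: nat
  assumes "M > 0"
  obtains e :: "nat \<Rightarrow> int" where "\<And>i. e i = 1 \<or> e i = -1"
    "\<And>n. n < 2 * M \<Longrightarrow> \<bar>pair_sum M e n\<bar> \<le> sqrt M * ln (4 * exp 1 * M)"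
proof -
  define s where "s = 1 / sqrt M"
  have s: "0 < s" "s \<le> 1" using assms by (auto simp: s_def)
  obtain e :: "nat \<Rightarrow> int" where e: "\<And>i. e i = 1 \<or> e i = -1"
    and pot: "(\<Sum>n<2*M. cosh (s * pair_sum M e n)) \<le> real (2*M) * cosh s ^ M"
    using signs_cosh_potential[where K="2*M"] by blast
  have "cosh s ^ M \<le> exp (s\<^sup>2) ^ M"
    using s by (intro power_mono cosh_le_exp_square) auto
  also have "\<dots> = exp 1" using assms by (simp add: exp_of_nat_mult[symmetric] s_def power_divide)
  finally have c: "cosh s ^ M \<le> exp 1" .
  have "\<bar>pair_sum M e n\<bar> \<le> sqrt M * ln (4 * exp 1 * M)" if "n < 2 * M" for n
  proof -
    define y where "y = s * \<bar>real_of_int (pair_sum M e n)\<bar>"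
    have "exp y / 2 \<le> cosh y" by (simp add: cosh_field_def)
    also have "\<dots> = cosh (s * pair_sum M e n)"
      using cosh_real_abs[of "s * pair_sum M e n"] s by (simp add: y_def abs_mult)
    also have "\<dots> \<le> (\<Sum>n<2*M. cosh (s * pair_sum M e n))"
      using that by (intro member_le_sum) auto
    also have "\<dots> \<le> real (2*M) * exp 1"
      using pot mult_left_mono[OF c, of "real (2*M)"] by simp
    finally have "exp y \<le> 4 * exp 1 * M" by (simp add: mult_ac)
    then have "y \<le> ln (4 * exp 1 * M)" using assms
      by (subst ln_ge_iff) auto
    then show ?thesis using assms by (simp add: y_def s_def field_simps)
  qed
  then show ?thesis using e that by blast
qed

text \<open>The reflection of \<open>i\<close> to \<open>n - i\<close> exchanges the two halves of
  the convolution and fixes only the diagonal term.\<close>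

lemma sum_mult_reflect:
  fixes f :: "nat \<Rightarrow> int"
  assumes f: "\<And>i. i \<ge> M \<Longrightarrow> f i = 0"
  shows "(\<Sum>i=0..n. f i * f (n - i)) = 2 * pair_sum M f n + (if even n then (f (n div 2))\<^sup>2 else 0)"
proof -
  define g where "g i = f i * f (n - i)" for i
  have low: "(\<Sum>i | i \<le> n \<and> n - i < i. g i) = pair_sum M f n"
  proof -
    have "pair_sum M f n = (\<Sum>j \<in> {j. j < M \<and> j \<le> n \<and> n - j < j}. g j)"
      unfolding pair_sum_def g_def by (simp add: sum.If_cases Int_def conj_ac)
    also have "\<dots> = (\<Sum>i | i \<le> n \<and> n - i < i. g i)"
    proof (rule sum.mono_neutral_left)
      show "finite {i. i \<le> n \<and> n - i < i}" by simp
      show "\<forall>i\<in>{i. i \<le> n \<and> n - i < i} - {j. j < M \<and> j \<le> n \<and> n - j < j}. g i = 0"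
      proof
        fix i assume "i \<in> {i. i \<le> n \<and> n - i < i} - {j. j < M \<and> j \<le> n \<and> n - j < j}"
        then have "M \<le> i" by auto
        then show "g i = 0" by (simp add: g_def f)
      qed
    qed auto
    finally show ?thesis ..
  qed
  have high: "(\<Sum>i | i \<le> n \<and> i < n - i. g i) = (\<Sum>i | i \<le> n \<and> n - i < i. g i)"
    by (rule sum.reindex_bij_witness[of _ "\<lambda>i. n - i" "\<lambda>i. n - i"]) (auto simp: g_def mult.commute)
  have diag: "(\<Sum>i | i \<le> n \<and> i = n - i. g i) = (if even n then (f (n div 2))\<^sup>2 else 0)"
  proof (cases "even n")
    case True
    then have "{i. i \<le> n \<and> i = n - i} = {n div 2}" by auto
    moreover have "n - n div 2 = n div 2" using True by auto
    ultimately show ?thesis using True by (simp add: g_def power2_eq_square)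
  next
    case False
    then have "{i. i \<le> n \<and> i = n - i} = {}" by (auto; presburger)
    then show ?thesis using False by (simp only: sum.empty if_False)
  qed
  have "{0..n} = {i. i \<le> n \<and> n - i < i} \<union> ({i. i \<le> n \<and> i < n - i} \<union> {i. i \<le> n \<and> i = n - i})"
    by auto
  then have "(\<Sum>i=0..n. g i) = (\<Sum>i | i \<le> n \<and> n - i < i. g i)
     + ((\<Sum>i | i \<le> n \<and> i < n - i. g i) + (\<Sum>i | i \<le> n \<and> i = n - i. g i))"
    by (simp add: sum.union_disjoint disjoint_iff)
  then show ?thesis using low high diag unfolding g_def by simp
qed

lemma signs_small_square:
  fixes M :: nat
  assumes "M > 0"
  obtains h :: "int fps" where "\<And>i. i < M \<Longrightarrow> h $ i = 1 \<or> h $ i = -1" "\<And>i. i \<ge> M \<Longrightarrow> h $ i = 0"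
    "\<And>n. \<bar>(h * h) $ n\<bar> \<le> 2 * sqrt M * ln (4 * exp 1 * M) + 1"
proof -
  obtain e :: "nat \<Rightarrow> int" where e: "\<And>i. e i = 1 \<or> e i = -1"
    and small: "\<And>n. n < 2 * M \<Longrightarrow> \<bar>pair_sum M e n\<bar> \<le> sqrt M * ln (4 * exp 1 * M)"
    using signs_small_pair_sums[OF assms] by blast
  define f where "f i = (if i < M then e i else 0)" for i
  have ln0: "0 \<le> ln (4 * exp 1 * real M)"
  proof (rule ln_ge_zero)
    have "1 \<le> exp 1 * real M" using assms mult_mono[of 1 "exp 1" 1 "real M"] by simp
    then show "1 \<le> 4 * exp 1 * real M" by simp
  qed
  have ps: "\<bar>pair_sum M f n\<bar> \<le> sqrt M * ln (4 * exp 1 * M)" for n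
  proof (cases "n < 2 * M")
    case True
    then show ?thesis using small pair_sum_cong[of M f e n] by (simp add: f_def)
  next
    case False
    \<comment> \<open>A term would need \<open>j < M\<close> and \<open>n - j < j\<close>, hence
      \<open>n < 2 * M\<close>.\<close>
    then have "pair_sum M f n = 0" unfolding pair_sum_def by (intro sum.neutral) auto
    then show ?thesis using ln0 by simp
  qed
  have "\<bar>(Abs_fps f * Abs_fps f) $ n\<bar> \<le> 2 * sqrt M * ln (4 * exp 1 * M) + 1" for n
  proof -
    have "\<bar>if even n then (f (n div 2))\<^sup>2 else 0\<bar> \<le> (1::int)"
      using e[of "n div 2"] by (auto simp: f_def)
    moreover have "(Abs_fps f * Abs_fps f) $ n = 2 * pair_sum M f n + (if even n then (f (n div 2))\<^sup>2 else 0)"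
      unfolding fps_mult_nth fps_nth_Abs_fps by (rule sum_mult_reflect) (simp add: f_def)
    ultimately have "\<bar>(Abs_fps f * Abs_fps f) $ n\<bar> \<le> 2 * \<bar>pair_sum M f n\<bar> + 1" by linarith
    then show ?thesis using ps[of n] by linarith
  qed
  with e show ?thesis by (intro that[of "Abs_fps f"]) (auto simp: f_def)
qed

subsection \<open>A dense set with bounded representation function\<close>

text \<open>The Erdos-Turan construction: the pair of \<open>k\<close> and
  \<open>k\<^sup>2 mod p\<close> is written in base \<open>2 * p\<close>, where adding two such
  numbers causes no carry in the lower digit.\<close>

definition quad_point :: "nat \<Rightarrow> nat \<Rightarrow> nat" where
  "quad_point p k = 2 * p * k + k\<^sup>2 mod p"

lemma quad_point_less: "k < p \<Longrightarrow> quad_point p k < 2 * p\<^sup>2"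
proof -
  assume k: "k < p"
  then have "p * Suc k \<le> p * p" by (intro mult_le_mono) auto
  moreover have "k\<^sup>2 mod p < p" using k by simp
  ultimately show ?thesis by (simp add: quad_point_def power2_eq_square algebra_simps)
qed

lemma quad_point_ge: "1 \<le> k \<Longrightarrow> 2 * p \<le> quad_point p k"
  by (cases k) (auto simp: quad_point_def)

text \<open>The increment \<open>2 * p\<close> per step exceeds by more than \<open>p\<close>
  whatever the residues below \<open>p\<close> can take away.\<close>

lemma quad_point_gap:
  assumes "i < j" "j < p"
  shows "quad_point p i + p < quad_point p j"
proof -
  have "p * Suc i \<le> p * j" using assms by (intro mult_le_mono) auto
  moreover have "i\<^sup>2 mod p < p" using assms by simp
  ultimately show ?thesis by (simp add: quad_point_def)
qed

lemma quad_point_inj: "inj_on (quad_point p) {..<p}"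
proof (rule linorder_inj_onI)
  fix x y assume "x < y" "x \<in> {..<p}" "y \<in> {..<p}"
  then show "quad_point p x \<noteq> quad_point p y" using quad_point_gap[of x y p] by auto
qed auto

text \<open>Without carries the sum determines \<open>k + k'\<close>, and
  \<open>k\<^sup>2 + k'\<^sup>2\<close> modulo \<open>p\<close>. Eliminating \<open>j'\<close>, the
  difference of the square sums is \<open>2 * (k - j) * (j - k')\<close>, and the odd prime
  \<open>p\<close> must divide one of the last two factors.\<close>

lemma quad_point_sum_eqD:
  assumes p: "prime p" "p > 2" and lt: "k < p" "k' < p" "j < p" "j' < p"
    and eq: "quad_point p k + quad_point p k' = quad_point p j + quad_point p j'"
  shows "j = k \<or> j = k'"
proof -
  have split: "x = y \<and> u = v" if "2 * p * x + u = 2 * p * y + v" "u < 2 * p" "v < 2 * p" for x y u v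
  proof -
    have "(2 * p * x + u) div (2 * p) = x" "(2 * p * y + v) div (2 * p) = y"
      using that(2,3) p by auto
    then show ?thesis using that(1) by auto
  qed
  have lt2: "a\<^sup>2 mod p + b\<^sup>2 mod p < 2 * p" for a b
    using p mod_less_divisor[of p "a\<^sup>2"] mod_less_divisor[of p "b\<^sup>2"] by linarith
  have "2 * p * (k + k') + (k\<^sup>2 mod p + k'\<^sup>2 mod p) = 2 * p * (j + j') + (j\<^sup>2 mod p + j'\<^sup>2 mod p)"
    using eq by (simp add: quad_point_def algebra_simps)
  from split[OF this lt2 lt2] have sum: "k + k' = j + j'"
    and sq: "k\<^sup>2 mod p + k'\<^sup>2 mod p = j\<^sup>2 mod p + j'\<^sup>2 mod p" by auto
  have "(k\<^sup>2 + k'\<^sup>2) mod p = (j\<^sup>2 + j'\<^sup>2) mod p"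
    using sq by (metis mod_add_eq)
  then have "int ((k\<^sup>2 + k'\<^sup>2) mod p) = int ((j\<^sup>2 + j'\<^sup>2) mod p)" by simp
  then have "(int k ^ 2 + int k' ^ 2) mod int p = (int j ^ 2 + int j' ^ 2) mod int p"
    by (simp add: of_nat_mod)
  then have "int p dvd (int k ^ 2 + int k' ^ 2) - (int j ^ 2 + int j' ^ 2)"
    by (simp add: mod_eq_dvd_iff)
  also have "(int k ^ 2 + int k' ^ 2) - (int j ^ 2 + int j' ^ 2) = 2 * (int k - int j) * (int j - int k')"
  proof -
    have "int j' = int k + int k' - int j" using sum by linarith
    then show ?thesis by (simp only:) (simp add: power2_eq_square algebra_simps)
  qed
  finally have "int p dvd 2 \<or> int p dvd int k - int j \<or> int p dvd int j - int k'"
    using p(1) by (simp only: prime_dvd_mult_iff prime_nat_int_transfer disj_assoc)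
  moreover have "\<not> int p dvd 2" using p(2) zdvd_imp_le[of "int p" 2] by auto
  moreover have "a = b" if "int p dvd int a - int b" "a < p" "b < p" for a b
  proof -
    have "int a mod int p = int b mod int p" using that(1) by (rule mod_eq_dvd_iff[THEN iffD2])
    then have "int (a mod p) = int (b mod p)" by (simp only: of_nat_mod)
    then show ?thesis using that(2,3) by simp
  qed
  ultimately show ?thesis using lt by metis
qed

lemma card_le_2I:
  assumes "finite Z" "\<And>x y. x \<in> Z \<Longrightarrow> y \<in> Z \<Longrightarrow> y = x \<or> y = f x"
  shows "card Z \<le> 2"
proof (cases "Z = {}")
  case False
  then obtain x where "x \<in> Z" by blast
  then have "Z \<subseteq> {x, f x}" using assms by blast
  then have "card Z \<le> card {x, f x}" by (intro card_mono) auto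
  also have "\<dots> \<le> 2" by (simp add: card_insert_if)
  finally show ?thesis .
qed simp

lemma card_le_1I:
  assumes "\<And>x y. x \<in> Z \<Longrightarrow> y \<in> Z \<Longrightarrow> y = x"
  shows "card Z \<le> 1"
proof (cases "Z = {}")
  case False
  then obtain x where "x \<in> Z" by blast
  then have "Z = {x}" using assms by blast
  then show ?thesis by simp
qed simp

text \<open>Points belonging to a prime \<open>p\<close> lie below \<open>2 * p\<^sup>2\<close>; the
  growth condition puts them below half of the next prime.\<close>

lemma sparse_primes:
  obtains q :: "nat \<Rightarrow> nat" where "\<And>j. prime (q j)" "\<And>j. q j > 2" "\<And>j. q (Suc j) > 4 * (q j)\<^sup>2"
proof -
  have "\<exists>q :: nat \<Rightarrow> nat. \<forall>j. (prime (q j) \<and> q j > 2) \<and> q (Suc j) > 4 * (q j)\<^sup>2"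
  proof (rule dependent_nat_choice)
    show "\<exists>x. prime x \<and> x > (2::nat)" using bigger_prime by blast
    fix x j :: nat
    obtain p where "prime p" "p > 4 * x\<^sup>2 + 2" using bigger_prime by blast
    then show "\<exists>y. (prime y \<and> y > 2) \<and> y > 4 * x\<^sup>2" by auto
  qed
  then show ?thesis using that by blast
qed

text \<open>A union of Erdos-Turan sets for rapidly growing primes: the level of the larger summand is
  determined by the sum, and the gaps within a level exceed all elements of the lower levels, so that
  mixed representations add at most two to the two representations within the level.\<close>

lemma infinite_Sidon_like:
  obtains S :: "nat set" where "\<And>n. R S (int n) \<le> 4"
    "\<And>X. \<exists>p>X. p - 1 \<le> card {s \<in> S. s < 2 * p\<^sup>2}"
proof -
  obtain q :: "nat \<Rightarrow> nat" where q: "\<And>j. prime (q j)" "\<And>j. q j > 2"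
    "\<And>j. q (Suc j) > 4 * (q j)\<^sup>2" by (rule sparse_primes) blast
  \<comment> \<open>The index 0 is left out since \<open>quad_point p 0 = 0\<close>; every element
    of level \<open>j\<close> is thus at least \<open>2 * q j\<close>.\<close>
  define Q where "Q j = quad_point (q j) ` {1..<q j}" for j
  define S where "S = (\<Union>j. Q j)"
  have "q j < q (Suc j)" for j
  proof -
    have "q j \<le> q j * q j" by simp
    then show ?thesis using q(3)[of j] unfolding power2_eq_square by linarith
  qed
  then have mono: "strict_mono q" by (simp add: strict_mono_Suc_iff)
  have sparse: "4 * (q i)\<^sup>2 < q j" if "i < j" for i j
    using q(3)[of i] that mono by (metis Suc_leI order_less_le_trans strict_mono_less_eq)
  have Q_lt: "a < 2 * (q j)\<^sup>2" if "a \<in> Q j" for a j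
    using that quad_point_less by (auto simp: Q_def)
  have Q_ge: "2 * q j \<le> a" if "a \<in> Q j" for a j
    using that quad_point_ge by (auto simp: Q_def)
  have gap: "a = b" if "a \<in> Q j" "b \<in> Q j" "a \<le> b" "b \<le> a + q j" for a b j
  proof -
    from that obtain x y where xy: "x < q j" "y < q j" "a = quad_point (q j) x" "b = quad_point (q j) y"
      by (auto simp: Q_def)
    then show ?thesis
      using that(3,4) quad_point_gap[of x y "q j"] quad_point_gap[of y x "q j"]
      by (cases x y rule: linorder_cases) auto
  qed
  have "R S (int n) \<le> 4" for n
  proof (cases "\<exists>J. 2 * q J \<le> n")
    case False
    have "2 * q j \<le> a + b" if "a \<in> Q j" for a b j using Q_ge[OF that] by simp
    with False have "{(a, a'). a \<in> S \<and> a' \<in> S \<and> int a + int a' = int n} = {}"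
      by (force simp: S_def simp flip: of_nat_add)
    then show ?thesis unfolding R_def by (simp only: card.empty)
  next
    case True
    \<comment> \<open>\<open>J\<close> is the highest level from which a summand of \<open>n\<close>
      can come.\<close>
    define J where "J = (GREATEST J. 2 * q J \<le> n)"
    have bound: "j \<le> n" if "2 * q j \<le> n" for j
      using that strict_mono_imp_increasing[OF mono, of j] by linarith
    from True obtain j where j: "2 * q j \<le> n" by blast
    have J: "2 * q J \<le> n"
      unfolding J_def by (rule GreatestI_nat[where P = "\<lambda>j. 2 * q j \<le> n", OF j bound])
    have J_max: "i \<le> J" if "2 * q i \<le> n" for i
      unfolding J_def by (rule Greatest_le_nat[where P = "\<lambda>j. 2 * q j \<le> n", OF that bound])
    define L where "L = {a. \<exists>j<J. a \<in> Q j}"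
    \<comment> \<open>Elements of lower levels are below \<open>q J / 2\<close>. So two of them
      cannot add up to \<open>n\<close>, and in two mixed representations the summands from
      \<open>Q J\<close> differ by less than \<open>q J\<close>, hence agree by
      \<open>gap\<close>.\<close>
    have L_lt: "4 * a < 2 * q J" if "a \<in> L" for a
      using that Q_lt sparse unfolding L_def by fastforce
    define P where "P X Y = {(a, a'). a \<in> X \<and> a' \<in> Y \<and> a + a' = n}" for X Y
    have fin: "finite (P X Y)" for X Y
      by (rule finite_subset[of _ "{..n} \<times> {..n}"]) (auto simp: P_def)
    have "{(a, a'). a \<in> S \<and> a' \<in> S \<and> int a + int a' = int n} \<subseteq> P (Q J) (Q J) \<union> (P (Q J) L \<union> P L (Q J))"
    proof
      fix z assume "z \<in> {(a, a'). a \<in> S \<and> a' \<in> S \<and> int a + int a' = int n}"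
      then obtain a a' where z: "z = (a, a')" and a: "a \<in> S" "a' \<in> S" "int a + int a' = int n"
        by blast
      then have n: "a + a' = n" by linarith
      have lev: "b \<in> Q J \<or> b \<in> L" if "b \<in> S" "b \<le> n" for b
      proof -
        from that obtain j where "b \<in> Q j" by (auto simp: S_def)
        then show ?thesis using Q_ge[of b j] J_max[of j] that(2)
          by (cases "j = J") (auto simp: L_def)
      qed
      have "\<not> (a \<in> L \<and> a' \<in> L)" using L_lt[of a] L_lt[of a'] n J by auto
      then show "z \<in> P (Q J) (Q J) \<union> (P (Q J) L \<union> P L (Q J))"
        using z lev[of a] lev[of a'] a n by (auto simp: P_def)
    qed
    then have "R S (int n) \<le> card (P (Q J) (Q J) \<union> (P (Q J) L \<union> P L (Q J)))"
      unfolding R_def using fin by (intro card_mono) auto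
    also have "\<dots> \<le> card (P (Q J) (Q J)) + (card (P (Q J) L) + card (P L (Q J)))"
      by (meson add_left_mono card_Un_le order_trans)
    also have "card (P (Q J) (Q J)) \<le> 2"
    proof (rule card_le_2I[OF fin, where f = "\<lambda>(a, a'). (a', a)"])
      fix x y assume "x \<in> P (Q J) (Q J)" "y \<in> P (Q J) (Q J)"
      then obtain i i' j j' where *: "i < q J" "i' < q J" "j < q J" "j' < q J"
        "x = (quad_point (q J) i, quad_point (q J) i')" "y = (quad_point (q J) j, quad_point (q J) j')"
        "quad_point (q J) i + quad_point (q J) i' = n" "quad_point (q J) j + quad_point (q J) j' = n"
        by (auto simp: P_def Q_def)
      have "j = i \<or> j = i'"
        using quad_point_sum_eqD[OF q(1) q(2) *(1-4)] *(7,8) by simp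
      then show "y = x \<or> y = (case x of (a, a') \<Rightarrow> (a', a))" using * by auto
    qed
    also have "card (P (Q J) L) \<le> 1"
    proof (rule card_le_1I)
      fix x y assume "x \<in> P (Q J) L" "y \<in> P (Q J) L"
      then show "y = x" using gap[of "fst x" J "fst y"] gap[of "fst y" J "fst x"] L_lt[of "snd x"] L_lt[of "snd y"]
        by (cases x; cases y; cases "fst x \<le> fst y") (auto simp: P_def)
    qed
    also have "card (P L (Q J)) \<le> 1"
    proof (rule card_le_1I)
      fix x y assume "x \<in> P L (Q J)" "y \<in> P L (Q J)"
      then show "y = x" using gap[of "snd x" J "snd y"] gap[of "snd y" J "snd x"] L_lt[of "fst x"] L_lt[of "fst y"]
        by (cases x; cases y; cases "snd x \<le> snd y") (auto simp: P_def)
    qed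
    finally show ?thesis by simp
  qed
  moreover have "\<exists>p>X. p - 1 \<le> card {s \<in> S. s < 2 * p\<^sup>2}" for X
  proof -
    have "Suc X \<le> q (Suc X)" using strict_mono_imp_increasing[OF mono] .
    moreover have "card (Q (Suc X)) = q (Suc X) - 1"
      unfolding Q_def by (subst card_image) (auto intro: inj_on_subset[OF quad_point_inj])
    moreover have "card (Q (Suc X)) \<le> card {s \<in> S. s < 2 * (q (Suc X))\<^sup>2}"
      using Q_lt by (intro card_mono) (auto simp: S_def)
    ultimately show ?thesis by (intro exI[of _ "q (Suc X)"]) auto
  qed
  ultimately show ?thesis using that by blast
qed

subsection \<open>Representation functions as power series\<close>

lemma fps_nth_compose_X_power:
  assumes "V > 0"
  shows "(q oo (fps_X ^ V)) $ n = (if V dvd n then q $ (n div V) else (0::'a::comm_ring_1))"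
proof -
  have "(q oo (fps_X ^ V)) $ n = (\<Sum>i=0..n. if n = V * i then q $ i else 0)"
    unfolding fps_compose_nth by (intro sum.cong) (auto simp flip: power_mult)
  also have "\<dots> = (if V dvd n then q $ (n div V) else 0)"
  proof (cases "V dvd n")
    case True
    then obtain k where k: "n = V * k" by blast
    then have "(if n = V * i then q $ i else 0) = (if i = k then q $ k else 0)" for i
      using assms by auto
    moreover have "k \<le> n" "n div V = k" using k assms by auto
    ultimately show ?thesis using True by simp
  qed (auto intro!: sum.neutral)
  finally show ?thesis .
qed

text \<open>The second factor lives on multiples of \<open>V\<close> and the first below
  \<open>V\<close>, so division with remainder leaves a single term of the convolution.\<close>

lemma fps_mult_compose_X_power_nth:
  fixes g q :: "'a::comm_ring_1 fps"
  assumes "V > 0" and g: "\<And>i. i \<ge> V \<Longrightarrow> g $ i = 0"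
  shows "(g * (q oo (fps_X ^ V))) $ n = g $ (n mod V) * q $ (n div V)"
proof -
  have "(g * (q oo (fps_X ^ V))) $ n = (\<Sum>i=0..n. g $ i * (q oo (fps_X ^ V)) $ (n - i))"
    by (simp add: fps_mult_nth)
  also have "\<dots> = (\<Sum>i\<in>{n mod V}. g $ i * (q oo (fps_X ^ V)) $ (n - i))"
  proof (rule sum.mono_neutral_right)
    show "\<forall>i\<in>{0..n} - {n mod V}. g $ i * (q oo (fps_X ^ V)) $ (n - i) = 0"
    proof
      fix i assume i: "i \<in> {0..n} - {n mod V}"
      show "g $ i * (q oo (fps_X ^ V)) $ (n - i) = 0"
      proof (cases "i < V")
        case True
        have "\<not> V dvd n - i"
        proof
          assume "V dvd n - i"
          then have "n mod V = i mod V" using i by (simp add: mod_eq_dvd_iff_nat)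
          then show False using True i by simp
        qed
        then show ?thesis using assms(1) by (simp add: fps_nth_compose_X_power)
      qed (simp add: g)
    qed
  qed (auto simp: mod_less_eq_dividend)
  also have "\<dots> = g $ (n mod V) * q $ (n div V)"
    using assms(1) by (simp add: fps_nth_compose_X_power dvd_minus_mod minus_mod_eq_mult_div)
  finally show ?thesis .
qed

lemma fps_compose_X_power_square:
  assumes "V > 0"
  shows "(q oo (fps_X ^ V)) * (q oo (fps_X ^ V)) = ((q * q) oo (fps_X ^ V) :: 'a::idom fps)"
  using assms by (intro fps_compose_mult_distrib[symmetric]) (simp add: power_0_left)

lemma abs_nth_one_minus_X_power_mult_le:
  fixes f :: "int fps"
  assumes "\<And>n. \<bar>f $ n\<bar> \<le> b"
  shows "\<bar>((1 - fps_X ^ k) * f) $ n\<bar> \<le> 2 * b"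
proof -
  have "((1 - fps_X ^ k) * f) $ n = f $ n - (if n < k then 0 else f $ (n - k))"
    by (simp add: left_diff_distrib fps_X_power_mult_nth)
  then show ?thesis using assms[of n] assms[of "n - k"] by (auto split: if_splits)
qed

definition ind_fps :: "nat set \<Rightarrow> int fps" where
  "ind_fps A = Abs_fps (indicator A)"

lemma ind_fps_nth: "ind_fps A $ n = (if n \<in> A then 1 else 0)"
  by (simp add: ind_fps_def indicator_def)

lemma R_eq_ind_fps_square: "int (R A (int n)) = (ind_fps A * ind_fps A) $ n"
proof -
  have "bij_betw (\<lambda>i. (i, n - i)) {i \<in> {0..n}. i \<in> A \<and> n - i \<in> A}
      {(a, a'). a \<in> A \<and> a' \<in> A \<and> int a + int a' = int n}"
    by (rule bij_betw_byWitness[where f' = fst]) (auto simp flip: of_nat_add)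
  then have "R A (int n) = card {i \<in> {0..n}. i \<in> A \<and> n - i \<in> A}"
    unfolding R_def by (simp only: bij_betw_same_card)
  also have "int \<dots> = (\<Sum>i=0..n. if i \<in> A \<and> n - i \<in> A then 1 else 0)"
    by (simp add: sum.If_cases Int_def)
  also have "\<dots> = (ind_fps A * ind_fps A) $ n"
    unfolding fps_mult_nth by (intro sum.cong) (auto simp: ind_fps_nth)
  finally show ?thesis .
qed

lemma R_neg: "n < 0 \<Longrightarrow> R A n = 0"
proof -
  assume "n < 0"
  then have "{(a, a'). a \<in> A \<and> a' \<in> A \<and> int a + int a' = n} = {}" by auto
  then show ?thesis unfolding R_def by (simp only: card.empty)
qed

lemma R_diff_eq:
  "int (R A (int n)) - int (R A (int n - 1)) = ((1 - fps_X) * (ind_fps A * ind_fps A)) $ n"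
proof (cases n)
  case 0
  then show ?thesis using R_eq_ind_fps_square[of A 0] by (simp add: R_neg)
next
  case (Suc m)
  then show ?thesis using R_eq_ind_fps_square[of A n] R_eq_ind_fps_square[of A m]
    by (simp add: left_diff_distrib)
qed

text \<open>Telescoping over unit steps; at negative arguments both representation numbers
  vanish.\<close>

lemma R_shift_diff_le:
  assumes D: "\<And>n. \<bar>((1 - fps_X) * (ind_fps A * ind_fps A)) $ n\<bar> \<le> D"
  shows "\<bar>int (R A (x - int i)) - int (R A x)\<bar> \<le> int i * D"
proof (induction i)
  case (Suc i)
  have "\<bar>int (R A y) - int (R A (y - 1))\<bar> \<le> D" for y
  proof (cases "y \<ge> 0")
    case True
    then show ?thesis using D[of "nat y"] R_diff_eq[of A "nat y"] by simp
  next
    case False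
    moreover have "0 \<le> D" using D[of 0] by linarith
    ultimately show ?thesis by (simp add: R_neg)
  qed
  from this[of "x - int i"] have "\<bar>int (R A (x - int i)) - int (R A (x - int (Suc i)))\<bar> \<le> D"
    by (simp only: of_nat_Suc diff_diff_eq add.commute)
  moreover have "int (Suc i) * D = int i * D + D" by (simp add: distrib_right)
  ultimately show ?case using Suc by linarith
qed simp

text \<open>As the coefficients add up to 0, the common value \<open>R A x\<close> may be subtracted
  from every term, which leaves shifts by at most \<open>d\<close>.\<close>

lemma combination_R_le:
  assumes D: "\<And>n. \<bar>((1 - fps_X) * (ind_fps A * ind_fps A)) $ n\<bar> \<le> D"
    and l: "(\<Sum>i=0..d. l i) = 0"
  shows "\<bar>\<Sum>i=0..d. l i * int (R A (x - int i))\<bar> \<le> int d * D * (\<Sum>i=0..d. \<bar>l i\<bar>)"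
proof -
  have D0: "0 \<le> D" using D[of 0] by linarith
  have "(\<Sum>i=0..d. l i * int (R A (x - int i)))
      = (\<Sum>i=0..d. l i * (int (R A (x - int i)) - int (R A x)))"
    using l by (simp add: right_diff_distrib sum_subtractf flip: sum_distrib_right)
  also have "\<bar>\<dots>\<bar> \<le> (\<Sum>i=0..d. \<bar>l i * (int (R A (x - int i)) - int (R A x))\<bar>)"
    by (rule sum_abs)
  also have "\<dots> \<le> (\<Sum>i=0..d. \<bar>l i\<bar> * (int d * D))"
  proof (rule sum_mono)
    fix i assume "i \<in> {0..d}"
    then have "int i * D \<le> int d * D" using D0 by (intro mult_right_mono) auto
    then show "\<bar>l i * (int (R A (x - int i)) - int (R A x))\<bar> \<le> \<bar>l i\<bar> * (int d * D)"
      unfolding abs_mult using R_shift_diff_le[OF D, of x i] by (intro mult_left_mono) auto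
  qed
  also have "\<dots> = int d * D * (\<Sum>i=0..d. \<bar>l i\<bar>)"
    by (simp only: sum_distrib_right[symmetric] mult.commute)
  finally show ?thesis .
qed

section \<open>Encoding signs by runs\<close>

lemma fps_numeral_mult_nth: "(numeral k * f) $ n = numeral k * (f $ n :: 'a::comm_ring_1)"
  by (simp only: numeral_fps_const fps_mult_left_const_nth)

definition ones_fps :: "nat \<Rightarrow> int fps" where
  "ones_fps L = ind_fps {..<L}"

lemma ones_fps_nth: "ones_fps L $ n = (if n < L then 1 else 0)"
  by (simp add: ones_fps_def ind_fps_nth)

lemma one_minus_X_mult_ones: "(1 - fps_X) * ones_fps L = 1 - fps_X ^ L"
proof (rule fps_ext)
  fix n
  show "((1 - fps_X) * ones_fps L) $ n = (1 - fps_X ^ L) $ n"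
    by (cases n) (auto simp: left_diff_distrib ones_fps_nth)
qed

text \<open>A sign \<open>h\<^sub>k\<close> is encoded by a block of length \<open>2 L\<close>, full on its first half and empty on its second
  half if \<open>h\<^sub>k = 1\<close>, the other way round if \<open>h\<^sub>k = -1\<close>. So every block contains a change preceded by
  a run of length \<open>L\<close>.\<close>

definition run_set :: "int fps \<Rightarrow> nat \<Rightarrow> nat \<Rightarrow> nat set" where
  "run_set h L M = {x. x < 2 * L * M \<and> (x mod (2 * L) < L \<longleftrightarrow> h $ (x div (2 * L)) = 1)}"

text \<open>Centring the indicator at its mean 1/2 and doubling gives \<open>h $ k\<close> on the
  first half of block \<open>k\<close> and the opposite value on the second half; the factor
  \<open>1 - fps_X ^ L\<close> produces this sign change.\<close>

lemma ind_fps_run_set: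
  assumes L: "L > 0" and h: "\<And>i. i < M \<Longrightarrow> h $ i = 1 \<or> h $ i = -1" "\<And>i. i \<ge> M \<Longrightarrow> h $ i = 0"
  shows "2 * ind_fps (run_set h L M)
    = ones_fps (2 * L * M) + (1 - fps_X ^ L) * (ones_fps L * (h oo (fps_X ^ (2 * L))))"
proof (rule fps_ext)
  fix n
  define w where "w = ones_fps L * (h oo (fps_X ^ (2 * L)))"
  have w: "w $ m = (if m mod (2 * L) < L then h $ (m div (2 * L)) else 0)" for m
    unfolding w_def using L by (subst fps_mult_compose_X_power_nth) (auto simp: ones_fps_nth)
  define k r where "k = n div (2 * L)" and "r = n mod (2 * L)"
  have r: "r < 2 * L" and n: "n = 2 * L * k + r" using L by (auto simp: k_def r_def)
  have w_n: "w $ n = (if r < L then h $ k else 0)" by (simp add: w k_def r_def)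
  \<comment> \<open>\<open>w\<close> lives on the first halves of blocks, so its shift by
    \<open>L\<close> lives on the second halves.\<close>
  have w_shift: "(if n < L then 0 else w $ (n - L)) = (if r < L then 0 else h $ k)"
  proof (cases "r < L")
    case True
    show ?thesis
    proof (cases "n < L")
      case False
      then obtain k' where k': "k = Suc k'" using True n by (cases k) auto
      have "n - L = 2 * L * k' + (r + L)" using n k' by simp
      then have "(n - L) mod (2 * L) = r + L" using True by simp
      then show ?thesis using True False by (simp add: w)
    qed (use True in auto)
  next
    case False
    have "n - L = 2 * L * k + (r - L)" using n False by simp
    then have "(n - L) mod (2 * L) = r - L" "(n - L) div (2 * L) = k" using r by auto
    then show ?thesis using False r n by (auto simp: w)
  qed
  have n_less: "n < 2 * L * M \<longleftrightarrow> k < M"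
  proof
    assume "k < M"
    then have "2 * L * Suc k \<le> 2 * L * M" by (intro mult_le_mono) auto
    then show "n < 2 * L * M" using n r by simp
  next
    assume *: "n < 2 * L * M"
    then show "k < M" unfolding k_def using L by (simp add: less_mult_imp_div_less mult.commute)
  qed
  have "((1 - fps_X ^ L) * w) $ n = (if r < L then h $ k else - (h $ k))"
    using w_n w_shift by (simp add: left_diff_distrib fps_X_power_mult_nth)
  then have rhs: "(ones_fps (2 * L * M) + (1 - fps_X ^ L) * w) $ n
      = (if k < M then 1 else 0) + (if r < L then h $ k else - (h $ k))"
    using n_less by (simp add: ones_fps_nth)
  have "n \<in> run_set h L M \<longleftrightarrow> k < M \<and> (r < L \<longleftrightarrow> h $ k = 1)"
    using n_less by (simp only: run_set_def k_def r_def mem_Collect_eq)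
  then have lhs: "(2 * ind_fps (run_set h L M)) $ n = (if k < M \<and> (r < L \<longleftrightarrow> h $ k = 1) then 2 else 0)"
    by (simp only: fps_numeral_mult_nth ind_fps_nth) simp
  show "(2 * ind_fps (run_set h L M)) $ n
    = (ones_fps (2 * L * M) + (1 - fps_X ^ L) * (ones_fps L * (h oo (fps_X ^ (2 * L))))) $ n"
    unfolding w_def[symmetric] lhs rhs
  proof (cases "k < M")
    case True
    show "(if k < M \<and> (r < L \<longleftrightarrow> h $ k = 1) then 2 else 0)
        = (if k < M then 1 else 0) + (if r < L then h $ k else - (h $ k))"
      using h(1)[OF True] True by (elim disjE) simp_all
  next
    case False
    then show "(if k < M \<and> (r < L \<longleftrightarrow> h $ k = 1) then 2 else 0)
        = (if k < M then 1 else 0) + (if r < L then h $ k else - (h $ k))"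
      using h(2)[of k] by simp
  qed
qed

text \<open>Writing \<open>2 T = I + e\<close>, the two geometric sums \<open>I\<close> (of length \<open>2 L M\<close>) and \<open>ones_fps L\<close> (a factor
  of \<open>e\<close>) both telescope against \<open>1 - X\<close>, which is what makes the bound independent of \<open>L\<close> and \<open>M\<close>.\<close>

lemma run_set_smooth:
  assumes L: "L > 0" and h: "\<And>i. i < M \<Longrightarrow> h $ i = 1 \<or> h $ i = -1" "\<And>i. i \<ge> M \<Longrightarrow> h $ i = 0"
    and E: "\<And>n. \<bar>(h * h) $ n\<bar> \<le> E"
  shows "4 * \<bar>((1 - fps_X) * (ind_fps (run_set h L M) * ind_fps (run_set h L M))) $ n\<bar> \<le> 6 + 8 * E"
proof -
  define T where "T = ind_fps (run_set h L M)"
  define I where "I = ones_fps (2 * L * M)"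
  define H where "H = h oo (fps_X ^ (2 * L))"
  define Y :: "int fps" where "Y = 1 - fps_X ^ L"
  define e where "e = Y * (ones_fps L * H)"
  have T2: "2 * T = I + e"
    using ind_fps_run_set[OF L h] by (simp add: T_def I_def e_def H_def Y_def)
  \<comment> \<open>\<open>I + 2 * e = 4 * T - I\<close>, whose coefficients are 0, -1 or 3 because
    \<open>T\<close> vanishes where \<open>I\<close> does.\<close>
  have Ie: "\<bar>(I + 2 * e) $ m\<bar> \<le> 3" for m
  proof -
    have "(2 * T) $ m = (I + e) $ m" using T2 by simp
    then have "2 * T $ m = I $ m + e $ m" by (simp only: fps_numeral_mult_nth fps_add_nth)
    moreover have "(I + 2 * e) $ m = I $ m + 2 * e $ m" by (simp only: fps_numeral_mult_nth fps_add_nth)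
    moreover have "T $ m = 0 \<or> T $ m = 1" "I $ m = 0 \<or> I $ m = 1" "I $ m = 0 \<Longrightarrow> T $ m = 0"
      by (auto simp: T_def I_def ones_fps_nth ind_fps_nth run_set_def)
    ultimately show ?thesis by linarith
  qed
  have base: "\<bar>(ones_fps L * ((h * h) oo (fps_X ^ (2 * L)))) $ m\<bar> \<le> E" for m
    using L E[of 0] E[of "m div (2 * L)"]
    by (subst fps_mult_compose_X_power_nth) (auto simp: ones_fps_nth)
  have HH: "H * H = (h * h) oo (fps_X ^ (2 * L))"
    unfolding H_def using L by (intro fps_compose_X_power_square) auto
  \<comment> \<open>Each \<open>e\<close> supplies one factor \<open>Y\<close>, and telescoping one
    of the two copies of \<open>ones_fps L\<close> supplies a third. Each of the three at most
    doubles the bound \<open>E\<close>.\<close>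
  have "(1 - fps_X) * (e * e) = Y * Y * ((1 - fps_X) * ones_fps L) * (ones_fps L * (H * H))"
    by (simp add: e_def algebra_simps)
  also have "\<dots> = Y * (Y * (Y * (ones_fps L * (H * H))))"
    by (simp add: one_minus_X_mult_ones Y_def mult.assoc)
  finally have e: "\<bar>((1 - fps_X) * (e * e)) $ m\<bar> \<le> 2 * (2 * (2 * E))" for m
    unfolding HH Y_def by (simp only:) (intro abs_nth_one_minus_X_power_mult_le base)
  have "4 * ((1 - fps_X) * (T * T)) = (1 - fps_X) * ((2 * T) * (2 * T))"
    by (simp add: algebra_simps)
  also have "\<dots> = ((1 - fps_X) * I) * (I + 2 * e) + (1 - fps_X) * (e * e)"
    unfolding T2 by (simp add: algebra_simps)
  also have "(1 - fps_X) * I = 1 - fps_X ^ (2 * L * M)"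
    by (simp add: I_def one_minus_X_mult_ones)
  finally have "4 * ((1 - fps_X) * (T * T)) =
    (1 - fps_X ^ (2 * L * M)) * (I + 2 * e) + (1 - fps_X) * (e * e)" .
  then have "(4 * ((1 - fps_X) * (T * T))) $ n =
    ((1 - fps_X ^ (2 * L * M)) * (I + 2 * e)) $ n + ((1 - fps_X) * (e * e)) $ n" by simp
  then have "4 * ((1 - fps_X) * (T * T)) $ n =
    ((1 - fps_X ^ (2 * L * M)) * (I + 2 * e)) $ n + ((1 - fps_X) * (e * e)) $ n" by (simp only: fps_numeral_mult_nth)
  moreover have "\<bar>((1 - fps_X ^ (2 * L * M)) * (I + 2 * e)) $ n\<bar> \<le> 2 * 3"
    by (intro abs_nth_one_minus_X_power_mult_le Ie)
  ultimately show ?thesis using e[of n] unfolding T_def by linarith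
qed

section \<open>Copies of a finite set placed along a sparse set\<close>

definition block_set :: "nat set \<Rightarrow> nat set \<Rightarrow> nat \<Rightarrow> nat set" where
  "block_set T S W = {n. n mod W \<in> T \<and> n div W \<in> S}"

lemma ind_fps_block_set:
  assumes "W > 0" "T \<subseteq> {..<W}"
  shows "ind_fps (block_set T S W) = ind_fps T * (ind_fps S oo (fps_X ^ W))"
proof (rule fps_ext)
  fix n
  have "ind_fps T $ i = 0" if "i \<ge> W" for i using that assms(2) by (auto simp: ind_fps_nth)
  then show "ind_fps (block_set T S W) $ n = (ind_fps T * (ind_fps S oo (fps_X ^ W))) $ n"
    using assms(1) by (simp add: fps_mult_compose_X_power_nth ind_fps_nth block_set_def)
qed

context
  fixes T S :: "nat set" and P :: nat and g :: nat
  assumes P: "P > 0" and T: "T \<subseteq> {..<P}" and S: "\<And>n. R S (int n) \<le> g"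
begin

text \<open>Two elements below \<open>P\<close> add up to at most \<open>2 * P - 2\<close>. This
  leaves room for the factor \<open>1 - fps_X\<close>, which raises the degree by one.\<close>

lemma ind_fps_square_eq_0: "i \<ge> 2 * P - 1 \<Longrightarrow> (ind_fps T * ind_fps T) $ i = 0"
proof -
  assume i: "i \<ge> 2 * P - 1"
  have "ind_fps T $ j * ind_fps T $ (i - j) = 0" if "j \<in> {0..i}" for j
  proof -
    have "\<not> (j < P \<and> i - j < P)" using i that by auto
    then show ?thesis using T by (auto simp: ind_fps_nth)
  qed
  then show ?thesis unfolding fps_mult_nth by (intro sum.neutral) blast
qed

lemma block_set_square:
  "ind_fps (block_set T S (2 * P)) * ind_fps (block_set T S (2 * P))
    = (ind_fps T * ind_fps T) * ((ind_fps S * ind_fps S) oo (fps_X ^ (2 * P)))"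
proof -
  have "T \<subseteq> {..<2 * P}" using T by auto
  with P have eq: "ind_fps (block_set T S (2 * P)) = ind_fps T * (ind_fps S oo (fps_X ^ (2 * P)))"
    by (intro ind_fps_block_set) auto
  have "(ind_fps S oo (fps_X ^ (2 * P))) * (ind_fps S oo (fps_X ^ (2 * P)))
      = (ind_fps S * ind_fps S) oo (fps_X ^ (2 * P))"
    using P by (intro fps_compose_X_power_square) auto
  then show ?thesis unfolding eq by (metis mult.assoc mult.left_commute)
qed

text \<open>\<open>G\<close> has degree below \<open>2 * P\<close>, so each coefficient is one
  coefficient of \<open>G\<close> times one value of \<open>R S\<close>.\<close>

lemma block_set_smooth:
  assumes D: "\<And>n. \<bar>((1 - fps_X) * (ind_fps T * ind_fps T)) $ n\<bar> \<le> D"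
  shows "\<bar>((1 - fps_X) * (ind_fps (block_set T S (2 * P)) * ind_fps (block_set T S (2 * P)))) $ n\<bar>
    \<le> int g * D"
proof -
  define G where "G = (1 - fps_X) * (ind_fps T * ind_fps T)"
  have G0: "G $ i = 0" if "i \<ge> 2 * P" for i
  proof -
    have "i \<noteq> 0" "i \<ge> 2 * P - 1" "i - 1 \<ge> 2 * P - 1" using that P by auto
    then show ?thesis unfolding G_def
      by (simp add: left_diff_distrib ind_fps_square_eq_0 del: fps_mult_nth_0)
  qed
  have "(1 - fps_X) * (ind_fps (block_set T S (2 * P)) * ind_fps (block_set T S (2 * P)))
      = G * ((ind_fps S * ind_fps S) oo (fps_X ^ (2 * P)))"
    unfolding block_set_square G_def by (simp only: mult.assoc)
  then have "\<bar>((1 - fps_X) * (ind_fps (block_set T S (2 * P)) * ind_fps (block_set T S (2 * P)))) $ n\<bar>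
    = \<bar>G $ (n mod (2 * P))\<bar> * int (R S (int (n div (2 * P))))"
    using P G0 by (simp add: fps_mult_compose_X_power_nth abs_mult flip: R_eq_ind_fps_square)
  also have "\<dots> \<le> D * int g"
    using D[folded G_def, of "n mod (2 * P)"] S[of "n div (2 * P)"]
    by (intro mult_mono) auto
  finally show ?thesis by (simp add: mult.commute)
qed

text \<open>A crude bound growing with \<open>P\<close>; it serves to keep \<open>B / sqrt n\<close>
  bounded.\<close>

lemma R_block_set_le: "R (block_set T S (2 * P)) (int n) \<le> 2 * P * g"
proof -
  define i where "i = n mod (2 * P)"
  have i: "i < 2 * P" using P by (simp add: i_def)
  have "int (R (block_set T S (2 * P)) (int n))
      = (ind_fps T * ind_fps T) $ i * int (R S (int (n div (2 * P))))"
    unfolding R_eq_ind_fps_square block_set_square i_def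
    using P ind_fps_square_eq_0 by (subst fps_mult_compose_X_power_nth) auto
  also have "\<dots> \<le> int (2 * P) * int g"
  proof (intro mult_mono)
    have "(ind_fps T * ind_fps T) $ i \<le> (\<Sum>j=0..i. 1)"
      unfolding fps_mult_nth by (intro sum_mono) (simp add: ind_fps_nth)
    also have "\<dots> \<le> int (2 * P)" using i by simp
    finally show "(ind_fps T * ind_fps T) $ i \<le> int (2 * P)" .
  qed (use S in auto)
  finally show ?thesis by (simp only: of_nat_mult[symmetric] of_nat_le_iff)
qed

end

section \<open>Upper and lower bounds for \<open>B\<close>\<close>

text \<open>The pairs of elements up to \<open>n\<close> are sorted by their sum, which is at most
  \<open>2 * n\<close>.\<close>

lemma card_square_le_R_bound:
  assumes "\<And>n. R A (int n) \<le> g"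
  shows "(card {a \<in> A. a \<le> n})\<^sup>2 \<le> (2 * n + 1) * g"
proof -
  define X where "X = {a \<in> A. a \<le> n}"
  define Z where "Z m = {(a, a'). a \<in> A \<and> a' \<in> A \<and> int a + int a' = int m}" for m
  have fin: "finite (Z m)" for m
    by (rule finite_subset[of _ "{..m} \<times> {..m}"]) (auto simp: Z_def)
  have "(card X)\<^sup>2 = card (X \<times> X)" by (simp add: card_cartesian_product power2_eq_square)
  also have "\<dots> \<le> card (\<Union>m\<in>{..2 * n}. Z m)"
  proof (rule card_mono)
    show "finite (\<Union>m\<in>{..2 * n}. Z m)" using fin by simp
    show "X \<times> X \<subseteq> (\<Union>m\<in>{..2 * n}. Z m)"
  proof
    fix z assume "z \<in> X \<times> X"
    then have "z \<in> Z (fst z + snd z)" "fst z + snd z \<le> 2 * n" by (auto simp: X_def Z_def)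
    then show "z \<in> (\<Union>m\<in>{..2 * n}. Z m)" by blast
  qed
  qed
  also have "\<dots> \<le> (\<Sum>m\<in>{..2 * n}. card (Z m))" by (intro card_UN_le) auto
  also have "\<dots> \<le> (\<Sum>m\<in>{..2 * n}. g)"
    using assms by (intro sum_mono) (simp add: R_def Z_def)
  finally show ?thesis by (simp add: X_def)
qed

lemma chi_eq: "chi A z = (if z \<ge> 0 \<and> nat z \<in> A then 1 else 0)"
  by (auto simp: chi_def indicator_def image_iff intro: bexI[of _ "nat z"])

text \<open>A nonzero combination at \<open>m\<close> requires an element of \<open>A\<close> among
  \<open>m - d, ..., m\<close>.\<close>

lemma B_le_card: "B A d l n \<le> (d + 1) * card {a \<in> A. a \<le> n}"
proof -
  let ?X = "{a \<in> A. a \<le> n}"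
  have "{m. m \<le> n \<and> (\<Sum>i=0..d. l i * chi A (int m - int i)) \<noteq> 0} \<subseteq> (\<lambda>(i, a). a + i) ` ({0..d} \<times> ?X)"
  proof
    fix m assume m: "m \<in> {m. m \<le> n \<and> (\<Sum>i=0..d. l i * chi A (int m - int i)) \<noteq> 0}"
    then obtain i where "i \<in> {0..d}" "l i * chi A (int m - int i) \<noteq> 0"
      by (metis (mono_tags, lifting) mem_Collect_eq sum.neutral)
    then have "i \<in> {0..d}" "i \<le> m" "m - i \<in> A"
      by (auto simp: chi_eq nat_diff_distrib split: if_splits)
    then show "m \<in> (\<lambda>(i, a). a + i) ` ({0..d} \<times> ?X)"
      using m by (intro image_eqI[of _ _ "(i, m - i)"]) auto
  qed
  then have "B A d l n \<le> card ((\<lambda>(i, a). a + i) ` ({0..d} \<times> ?X))"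
    unfolding B_def by (intro card_mono) auto
  also have "\<dots> \<le> card ({0..d} \<times> ?X)" by (intro card_image_le) auto
  finally show ?thesis by (simp add: card_cartesian_product)
qed

text \<open>Since the coefficients add up to \<open>0\<close>, they annihilate a constant run; the first nonzero one then
  detects the change at \<open>q\<close>.\<close>

lemma combination_chi_nonzero:
  fixes l :: "nat \<Rightarrow> int"
  assumes l: "(\<Sum>i=0..d. l i) = 0" and i0: "l i0 \<noteq> 0" "i0 \<le> d" "\<And>i. i < i0 \<Longrightarrow> l i = 0"
    and q: "d \<le> q" and change: "\<And>j. 1 \<le> j \<Longrightarrow> j \<le> d \<Longrightarrow> q - j \<in> A \<longleftrightarrow> q \<notin> A"
  shows "(\<Sum>i=0..d. l i * chi A (int (q + i0) - int i)) \<noteq> 0"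
proof -
  define c :: int where "c = (if q \<in> A then 1 else 0)"
  have "l i * chi A (int (q + i0) - int i) = l i * (1 - c) + (if i = i0 then l i0 * (2 * c - 1) else 0)"
    if "i \<in> {0..d}" for i
  proof (cases i i0 rule: linorder_cases)
    case greater
    then have eq: "int (q + i0) - int i = int (q - (i - i0))" using that q by auto
    have "q - (i - i0) \<in> A \<longleftrightarrow> q \<notin> A" using greater that by (intro change) auto
    then show ?thesis using greater unfolding eq by (simp add: chi_eq c_def)
  qed (auto simp: chi_eq c_def i0)
  then have "(\<Sum>i=0..d. l i * chi A (int (q + i0) - int i))
    = (\<Sum>i=0..d. l i * (1 - c) + (if i = i0 then l i0 * (2 * c - 1) else 0))"
    by (intro sum.cong) auto
  also have "\<dots> = l i0 * (2 * c - 1)"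
    using l i0(2) by (simp add: sum.distrib flip: sum_distrib_right)
  finally show ?thesis using i0(1) by (auto simp: c_def)
qed

text \<open>The middle of every block is a change preceded by a run of length \<open>L > d\<close>,
  whichever sign the block encodes. Each copy of the run set therefore yields \<open>M\<close>
  distinct points counted by \<open>B\<close>.\<close>

lemma B_block_set_ge:
  fixes l :: "nat \<Rightarrow> int"
  assumes l: "(\<Sum>i=0..d. \<bar>l i\<bar>) > 0" "(\<Sum>i=0..d. l i) = 0"
    and L: "L = d + 1" and W: "W = 2 * (2 * L * M)"
    and h: "\<And>i. i < M \<Longrightarrow> h $ i = 1 \<or> h $ i = -1"
  shows "M * card {s \<in> S. s < X} \<le> B (block_set (run_set h L M) S W) d l (W * X)"
proof -
  let ?A = "block_set (run_set h L M) S W"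
  have "\<exists>i. l i \<noteq> 0 \<and> i \<le> d"
  proof (rule ccontr)
    assume "\<not> ?thesis"
    then have "(\<Sum>i=0..d. \<bar>l i\<bar>) = 0" by (intro sum.neutral) auto
    then show False using l(1) by simp
  qed
  then obtain i1 where i1: "l i1 \<noteq> 0" "i1 \<le> d" by blast
  define i0 where "i0 = (LEAST i. l i \<noteq> 0)"
  have i0: "l i0 \<noteq> 0" "i0 \<le> d" "\<And>i. i < i0 \<Longrightarrow> l i = 0"
    unfolding i0_def
  proof -
    show "l (LEAST i. l i \<noteq> 0) \<noteq> 0" using i1(1) by (rule LeastI)
    show "(LEAST i. l i \<noteq> 0) \<le> d" using Least_le[of "\<lambda>i. l i \<noteq> 0" i1] i1 by linarith
    show "l i = 0" if "i < (LEAST i. l i \<noteq> 0)" for i using not_less_Least[OF that] by simp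
  qed
  \<comment> \<open>\<open>u k\<close> is the middle of block \<open>k\<close>. The detecting point
    \<open>u k + i0\<close> stays in the same block since \<open>i0 \<le> d < L\<close>.\<close>
  define u where "u k = 2 * L * k + L" for k
  have u: "u k + L \<le> 2 * L * M" if "k < M" for k
  proof -
    have "2 * L * Suc k \<le> 2 * L * M" using that by (intro mult_le_mono) auto
    then show ?thesis by (simp add: u_def)
  qed
  have mem: "W * s + v \<in> ?A \<longleftrightarrow> v \<in> run_set h L M" if "s \<in> S" "v < W" for s v
    using that by (simp add: block_set_def)
  have run: "2 * L * k + r \<in> run_set h L M \<longleftrightarrow> (r < L \<longleftrightarrow> h $ k = 1)" if "r < 2 * L" "k < M" for k r
  proof -
    have "(2 * L * k + r) div (2 * L) = k" "(2 * L * k + r) mod (2 * L) = r" using that by auto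
    moreover have "2 * L * k + r < 2 * L * M" using u[OF that(2)] that(1) by (simp add: u_def)
    ultimately show ?thesis by (simp only: run_set_def mem_Collect_eq simp_thms)
  qed
  let ?f = "\<lambda>(s, k). W * s + u k + i0"
  have "inj_on ?f ({s \<in> S. s < X} \<times> {..<M})"
  proof (rule inj_onI, clarsimp)
    fix s k s' k' assume *: "W * s + u k = W * s' + u k'" "k < M" "k' < M"
    have lt: "u k < W" "u k' < W" using u[OF *(2)] u[OF *(3)] L W by auto
    have "(W * s + u k) div W = s" "(W * s' + u k') div W = s'" using lt by auto
    then have "s = s'" using *(1) by simp
    then have "u k = u k'" using *(1) by simp
    moreover have "L > 0" using L by simp
    ultimately have "k = k'" by (simp add: u_def)
    with \<open>s = s'\<close> show "s = s' \<and> k = k'" by simp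
  qed
  then have "M * card {s \<in> S. s < X} = card (?f ` ({s \<in> S. s < X} \<times> {..<M}))"
    by (simp add: card_image card_cartesian_product)
  also have "\<dots> \<le> B ?A d l (W * X)"
    unfolding B_def
  proof (intro card_mono subsetI)
    fix m assume "m \<in> ?f ` ({s \<in> S. s < X} \<times> {..<M})"
    then obtain s k where s: "s \<in> S" "s < X" and k: "k < M" and m: "m = W * s + u k + i0" by auto
    have uW: "u k + i0 < W" using u[OF k] i0(2) L W by auto
    have "W * Suc s \<le> W * X" using s(2) by (intro mult_le_mono) auto
    then have "m \<le> W * X" using m uW by simp
    moreover have "(\<Sum>i=0..d. l i * chi ?A (int (W * s + u k + i0) - int i)) \<noteq> 0"
    proof (rule combination_chi_nonzero[OF l(2) i0])
      show "d \<le> W * s + u k" using L by (simp add: u_def)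
      fix j assume j: "1 \<le> j" "j \<le> d"
      have eq: "W * s + u k - j = W * s + (2 * L * k + (L - j))" using j L by (simp add: u_def)
      have lt: "2 * L * k + (L - j) < W" "L - j < L" using uW j L by (simp_all add: u_def)
      have "W * s + u k - j \<in> ?A \<longleftrightarrow> h $ k = 1"
        unfolding eq using mem[OF s(1) lt(1)] run[of "L - j" k] lt(2) k by simp
      moreover have "W * s + u k \<in> ?A \<longleftrightarrow> h $ k \<noteq> 1"
        using mem[OF s(1), of "u k"] uW run[of L k] k L unfolding u_def by simp
      ultimately show "W * s + u k - j \<in> ?A \<longleftrightarrow> W * s + u k \<notin> ?A" by simp
    qed
    ultimately show "m \<in> {m. m \<le> W * X \<and> (\<Sum>i=0..d. l i * chi ?A (int m - int i)) \<noteq> 0}"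
      using m by simp
  qed auto
  finally show ?thesis .
qed

subsection \<open>The construction\<close>

lemma small_combination_many_changes:
  fixes d M :: nat and l :: "nat \<Rightarrow> int"
  assumes l: "(\<Sum>i=0..d. \<bar>l i\<bar>) > 0" "(\<Sum>i=0..d. l i) = 0" and M: "M > 0"
  obtains A C where
    "\<And>n. \<bar>\<Sum>i=0..d. l i * int (R A (int n - int i))\<bar>
      \<le> real d * 4 * (14 + 16 * sqrt M * ln (4 * exp 1 * M)) * (\<Sum>i=0..d. \<bar>l i\<bar>)"
    "\<And>n. B A d l n / sqrt n \<le> C"
    "\<And>X. \<exists>n>X. sqrt (M / (32 * (d + 1))) \<le> B A d l n / sqrt n"
proof -
  define L where "L = d + 1"
  define P where "P = 2 * L * M"
  have P: "P > 0" using M by (simp add: P_def L_def)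
  \<comment> \<open>The power series have integer coefficients, so the real bound is rounded down to
    an integer.\<close>
  define E where "E = \<lfloor>2 * sqrt M * ln (4 * exp 1 * M) + 1\<rfloor>"
  obtain h :: "int fps" where h: "\<And>i. i < M \<Longrightarrow> h $ i = 1 \<or> h $ i = -1"
    "\<And>i. i \<ge> M \<Longrightarrow> h $ i = 0"
    and hE: "\<And>n. \<bar>(h * h) $ n\<bar> \<le> 2 * sqrt M * ln (4 * exp 1 * M) + 1"
    by (rule signs_small_square[OF M]) blast
  have E: "\<bar>(h * h) $ n\<bar> \<le> E" for n using hE[of n] unfolding E_def by (simp only: le_floor_iff)
  have E_le: "of_int E \<le> 2 * sqrt M * ln (4 * exp 1 * M) + 1"
    unfolding E_def by (rule of_int_floor_le)
  obtain S where S: "\<And>n. R S (int n) \<le> 4"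
    and S_dense: "\<And>X. \<exists>p>X. p - 1 \<le> card {s \<in> S. s < 2 * p\<^sup>2}"
    by (rule infinite_Sidon_like) blast
  define T where "T = run_set h L M"
  have T: "T \<subseteq> {..<P}" by (auto simp: T_def run_set_def P_def)
  define A where "A = block_set T S (2 * P)"
  have "\<bar>((1 - fps_X) * (ind_fps T * ind_fps T)) $ n\<bar> \<le> 6 + 8 * E" for n
    using run_set_smooth[of L M h E n] h E unfolding T_def L_def by simp
  then have smooth: "\<bar>((1 - fps_X) * (ind_fps A * ind_fps A)) $ n\<bar> \<le> int 4 * (6 + 8 * E)" for n
    unfolding A_def by (rule block_set_smooth[OF P T S])
  have 1: "\<bar>\<Sum>i=0..d. l i * int (R A (int n - int i))\<bar>
      \<le> real d * 4 * (14 + 16 * sqrt M * ln (4 * exp 1 * M)) * (\<Sum>i=0..d. \<bar>l i\<bar>)" for n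
  proof -
    have "real_of_int \<bar>\<Sum>i=0..d. l i * int (R A (int n - int i))\<bar>
      \<le> real_of_int (int d * (int 4 * (6 + 8 * E)) * (\<Sum>i=0..d. \<bar>l i\<bar>))"
      unfolding of_int_le_iff by (rule combination_R_le[OF smooth l(2)])
    also have "\<dots> = real d * 4 * (6 + 8 * real_of_int E) * real_of_int (\<Sum>i=0..d. \<bar>l i\<bar>)"
      by (simp only: of_int_mult of_int_add of_int_of_nat_eq of_int_numeral of_nat_numeral mult.assoc)
    also have "\<dots> \<le> real d * 4 * (14 + 16 * sqrt M * ln (4 * exp 1 * M)) * real_of_int (\<Sum>i=0..d. \<bar>l i\<bar>)"
      using E_le l(1) by (intro mult_right_mono mult_left_mono) auto
    finally show ?thesis .
  qed
  \<comment> \<open>The constant is \<open>24 = 3 * 2 * 4\<close>, from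
    \<open>2 * n + 1 \<le> 3 * n\<close> and the bound \<open>2 * P * 4\<close> for
    \<open>R A\<close>. At \<open>n = 0\<close> the quotient is 0 by convention.\<close>
  have 2: "B A d l n / sqrt n \<le> real (d + 1) * sqrt (24 * P)" for n
  proof (cases "n = 0")
    case False
    have "(card {a \<in> A. a \<le> n})\<^sup>2 \<le> (2 * n + 1) * (2 * P * 4)"
      unfolding A_def by (intro card_square_le_R_bound R_block_set_le[OF P T S])
    also have "\<dots> \<le> (3 * n) * (2 * P * 4)" using False by (intro mult_right_mono) auto
    finally have "(card {a \<in> A. a \<le> n})\<^sup>2 \<le> 24 * P * n" by (simp add: mult_ac)
    then have "real ((card {a \<in> A. a \<le> n})\<^sup>2) \<le> real (24 * P * n)" by (simp only: of_nat_le_iff)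
    then have "real (card {a \<in> A. a \<le> n}) \<le> sqrt (24 * P * n)"
      by (intro real_le_rsqrt) simp
    then have "real (d + 1) * real (card {a \<in> A. a \<le> n}) \<le> real (d + 1) * sqrt (24 * P * n)"
      by (intro mult_left_mono) auto
    moreover have "real (B A d l n) \<le> real (d + 1) * real (card {a \<in> A. a \<le> n})"
      using B_le_card[of A d l n] by (simp only: of_nat_mult[symmetric] of_nat_le_iff)
    ultimately show ?thesis using False by (simp add: field_simps real_sqrt_mult)
  qed simp
  have 3: "\<exists>n>X. sqrt (M / (32 * (d + 1))) \<le> B A d l n / sqrt n" for X
  proof -
    \<comment> \<open>\<open>p \<ge> 2\<close> ensures \<open>p - 1 \<ge> p / 2\<close>. With
      \<open>n = 8 * (d + 1) * M * p\<^sup>2\<close> the claimed constant times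
      \<open>sqrt n\<close> is exactly \<open>M * p / 2\<close>.\<close>
    obtain p where p: "p > X + 1" "p - 1 \<le> card {s \<in> S. s < 2 * p\<^sup>2}" using S_dense by blast
    define n where "n = 2 * P * (2 * p\<^sup>2)"
    have "M * (p - 1) \<le> M * card {s \<in> S. s < 2 * p\<^sup>2}" using p(2) by simp
    also have "\<dots> \<le> B A d l n" unfolding A_def T_def n_def
      by (rule B_block_set_ge[OF l]) (use h P_def L_def in auto)
    finally have "real (M * (p - 1)) \<le> real (B A d l n)" by (simp only: of_nat_le_iff)
    moreover have "real p / 2 \<le> real (p - 1)" using p(1) by (simp add: of_nat_diff)
    then have "real M * (real p / 2) \<le> real (M * (p - 1))"
      unfolding of_nat_mult by (intro mult_left_mono) auto
    ultimately have B: "real M * (real p / 2) \<le> real (B A d l n)" by linarith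
    have n_eq: "real n = real (8 * (d + 1) * M) * (real p)\<^sup>2"
      by (simp add: n_def P_def L_def algebra_simps)
    have "sqrt (M / (32 * (d + 1))) * sqrt n = sqrt ((real M * (real p / 2))\<^sup>2)"
      unfolding n_eq real_sqrt_mult[symmetric] by (simp add: field_simps power2_eq_square)
    also have "\<dots> = real M * (real p / 2)" by simp
    finally have "sqrt (M / (32 * (d + 1))) * sqrt n \<le> real (B A d l n)" using B by linarith
    moreover have "p \<le> n"
    proof -
      have "p * 1 \<le> p * p * (4 * P)" using P p(1) by (simp add: mult.assoc)
      then show ?thesis by (simp add: n_def power2_eq_square mult_ac)
    qed
    ultimately show ?thesis using p(1) by (intro exI[of _ n]) (simp add: field_simps)
  qed
  from that[OF 1 2 3] show ?thesis .
qed

section \<open>Comparison of the limits superior\<close>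

lemma le_limsup_of_frequently:
  fixes f :: "nat \<Rightarrow> 'a::complete_linorder"
  assumes "\<And>X. \<exists>n>X. c \<le> f n"
  shows "c \<le> limsup f"
  unfolding limsup_INF_SUP
proof (rule INF_greatest)
  fix X
  obtain n where "n > X" "c \<le> f n" using assms by blast
  then show "c \<le> (SUP m\<in>{X..}. f m)" by (intro SUP_upper2[of n]) auto
qed

text \<open>The left side has order \<open>sqrt M * ln M\<close>, the right side order
  \<open>M powr (3/4)\<close>.\<close>

lemma eventually_sqrt_log_bound:
  fixes a b :: real
  assumes "a > 0" "b > 0"
  shows "eventually (\<lambda>M::nat. a * (14 + 16 * sqrt M * ln (4 * exp 1 * M)) \<le> sqrt (M / b) powr (3/2)) at_top"
  using assms by real_asymp

lemma eventually_sqrt_ge: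
  fixes b c :: real
  assumes "b > 0"
  shows "eventually (\<lambda>M::nat. c \<le> sqrt (M / b)) at_top"
proof -
  have "filterlim (\<lambda>M::nat. sqrt (M / b)) at_top at_top" using assms by real_asymp
  then show ?thesis by (simp add: filterlim_at_top)
qed

theorem theorem4:
  fixes d :: nat and l :: "nat \<Rightarrow> int" and N :: nat
  assumes "(\<Sum>i=0..d. \<bar>l i\<bar>) > 0"
    and "(\<Sum>i=0..d. l i) = 0"
    and "N > 0"
  shows "\<exists>A :: nat set.
    ereal (real N) \<le> limsup (\<lambda>n. ereal (real (B A d l n) / sqrt (real n))) \<and>
    limsup (\<lambda>n. ereal (real (B A d l n) / sqrt (real n))) < \<infinity> \<and>
    limsup (\<lambda>n. ereal (real_of_int \<bar>\<Sum>i=0..d. l i * int (R A (int n - int i))\<bar>))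
      \<le> limsup (\<lambda>n. ereal (48 * (real d + 1) ^ 4 * 2 powr (3 * real d + 7.5)
            * real_of_int (\<Sum>i=0..d. \<bar>l i\<bar>)
            * (real (B A d l n) / sqrt (real n)) powr (3/2)
            * sqrt (ln (real (B A d l n) / sqrt (real n)))))"
proof -
  define lam where "lam = real_of_int (\<Sum>i=0..d. \<bar>l i\<bar>)"
  have "1 \<le> (\<Sum>i=0..d. \<bar>l i\<bar>)" using assms(1) by linarith
  then have "real_of_int 1 \<le> lam" unfolding lam_def by (simp only: of_int_le_iff)
  then have lam: "lam \<ge> 1" by simp
  \<comment> \<open>The summand 1 keeps \<open>a\<close> positive when \<open>d = 0\<close>.\<close>
  define a where "a = real d * 4 * lam + 1"
  define b where "b = real (32 * (d + 1))"
  have ab: "a > 0" "b > 0" using lam by (auto simp: a_def b_def add_nonneg_pos)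
  \<comment> \<open>Requiring \<open>exp 1\<close> as a lower bound makes the logarithm of every
    \<open>x \<ge> c\<close> at least 1, so the root of the logarithm does not lower the right
    side.\<close>
  have "eventually (\<lambda>M::nat. (0::nat) < M \<and> max (real N) (exp 1) \<le> sqrt (M / b) \<and>
      a * (14 + 16 * sqrt M * ln (4 * exp 1 * M)) \<le> sqrt (M / b) powr (3/2)) at_top"
    by (intro eventually_conj eventually_gt_at_top eventually_sqrt_ge eventually_sqrt_log_bound ab)
  then obtain M :: nat where M: "M > 0" and c_ge: "max (real N) (exp 1) \<le> sqrt (M / b)"
    and bound: "a * (14 + 16 * sqrt M * ln (4 * exp 1 * M)) \<le> sqrt (M / b) powr (3/2)"
    by (auto simp only: eventually_sequentially)
  define c where "c = sqrt (M / b)"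
  have c: "real N \<le> c" "exp 1 \<le> c" using c_ge by (auto simp: c_def)
  obtain A C where small: "\<And>n. \<bar>\<Sum>i=0..d. l i * int (R A (int n - int i))\<bar>
      \<le> real d * 4 * (14 + 16 * sqrt M * ln (4 * exp 1 * M)) * lam"
    and upper: "\<And>n. B A d l n / sqrt n \<le> C"
    and lower: "\<And>X. \<exists>n>X. c \<le> B A d l n / sqrt n"
    using small_combination_many_changes[OF assms(1,2) M] unfolding lam_def c_def b_def by blast
  define K where "K = 48 * (real d + 1) ^ 4 * 2 powr (3 * real d + 7.5) * lam"
  have K: "1 \<le> K"
  proof -
    have "1 \<le> (real d + 1) ^ 4" by simp
    moreover have "1 \<le> 2 powr (3 * real d + 7.5)" by (simp add: ge_one_powr_ge_zero)
    ultimately have "1 * 1 * 1 * 1 \<le> 48 * (real d + 1) ^ 4 * 2 powr (3 * real d + 7.5) * lam"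
      using lam by (intro mult_mono) auto
    then show ?thesis by (simp add: K_def)
  qed
  have large: "c powr (3/2) \<le> K * x powr (3/2) * sqrt (ln x)" if "c \<le> x" for x
  proof -
    have "exp 1 \<le> x" using that c by linarith
    moreover have "0 < x" using that c(2) exp_gt_zero[of 1] by linarith
    ultimately have "1 \<le> ln x" by (simp add: ln_ge_iff)
    then have "1 \<le> sqrt (ln x)" by simp
    moreover have "c powr (3/2) \<le> x powr (3/2)"
      using that ab(2) by (intro powr_mono2) (auto simp: c_def)
    ultimately have "1 * c powr (3/2) * 1 \<le> K * x powr (3/2) * sqrt (ln x)"
      using K by (intro mult_mono) auto
    then show ?thesis by simp
  qed
  have "ereal (real N) \<le> limsup (\<lambda>n. ereal (B A d l n / sqrt n))"
  proof (rule le_limsup_of_frequently)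
    show "\<exists>n>X. ereal (real N) \<le> ereal (B A d l n / sqrt n)" for X
      using lower[of X] c(1) by fastforce
  qed
  moreover have "limsup (\<lambda>n. ereal (B A d l n / sqrt n)) < \<infinity>"
  proof -
    have "limsup (\<lambda>n. ereal (B A d l n / sqrt n)) \<le> ereal C"
      using upper by (intro Limsup_bounded always_eventually) simp
    then show ?thesis by (rule order_le_less_trans) simp
  qed
  moreover have "limsup (\<lambda>n. ereal (real_of_int \<bar>\<Sum>i=0..d. l i * int (R A (int n - int i))\<bar>))
      \<le> limsup (\<lambda>n. ereal (K * (B A d l n / sqrt n) powr (3/2) * sqrt (ln (B A d l n / sqrt n))))"
  proof (rule order_trans)
    \<comment> \<open>The value \<open>c powr (3/2)\<close> separates the two sides: it bounds the
      left terms for all \<open>n\<close> and is reached or exceeded by the right terms infinitely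
      often.\<close>
    let ?Z = "14 + 16 * sqrt M * ln (4 * exp 1 * M)"
    have "0 \<le> ?Z"
    proof -
      have "1 \<le> exp 1 * real M" using M mult_mono[of 1 "exp 1" 1 "real M"] by simp
      then have "0 \<le> ln (4 * exp 1 * M)" by (intro ln_ge_zero) linarith
      then show ?thesis by (intro add_nonneg_nonneg mult_nonneg_nonneg) auto
    qed
    then have "real d * 4 * ?Z * lam \<le> a * ?Z" by (simp add: a_def algebra_simps)
    then have "real_of_int \<bar>\<Sum>i=0..d. l i * int (R A (int n - int i))\<bar> \<le> c powr (3/2)" for n
      using small[of n] bound unfolding c_def by linarith
    then show "limsup (\<lambda>n. ereal (real_of_int \<bar>\<Sum>i=0..d. l i * int (R A (int n - int i))\<bar>))
        \<le> ereal (c powr (3/2))"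
      by (intro Limsup_bounded always_eventually) simp
    show "ereal (c powr (3/2))
        \<le> limsup (\<lambda>n. ereal (K * (B A d l n / sqrt n) powr (3/2) * sqrt (ln (B A d l n / sqrt n))))"
    proof (rule le_limsup_of_frequently)
      show "\<exists>n>X. ereal (c powr (3/2)) \<le> ereal (K * (B A d l n / sqrt n) powr (3/2) * sqrt (ln (B A d l n / sqrt n)))" for X
        using lower[of X] large by (auto simp del: powr_gt_zero)
    qed
  qed
  ultimately show ?thesis unfolding K_def lam_def by blast
qed

end
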